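(* Let $\Gamma_1=(G_1,\sigma_1)$ be a signed bipartite graph of order $n$ and $\Gamma_2=(G_2,\sigma_2)$ be a signed graph of order $m$, and let $\lambda^2$ and $\mu^2$ be the minimum eigenvalues of $A(\Gamma_1)^2$ and $A(\Gamma_2)^2$, respectively. Let $H$ and $H'$ be any $(\lfloor\frac{mn}{2}\rfloor+1)$-vertex induced subgraphs of the signed Cartesian product $\Gamma_1\widetilde{\Box}\Gamma_2$ and of the signed semi-strong product $\Gamma_1\widetilde{\bowtie}\Gamma_2$, respectively. If $\Gamma_1$ is a balanced bipartite graph or the spectrum of $\Gamma_2$ is symmetric, then $$\Delta(H)\geq\sqrt{\lambda^2+\mu^2},\qquad \Delta(H')\geq\sqrt{(\lambda^2+1)\mu^2}.$$
   Context: A signed graph $\Gamma=(G,\sigma)$ is a finite simple undirected graph $G$ together with a map $\sigma:E(G)\to\{+1,-1\}$. Its adjacency matrix $A(\Gamma)$ is the real symmetric matrix indexed by $V(G)$ whose $(u,v)$ entry is $\sigma(uv)$ if $u,v$ are adjacent and $0$ otherwise. The eigenvalues (spectrum) of $\Gamma$ are those of $A(\Gamma)$; the spectrum is symmetric if, counted with multiplicity, it is invariant under $x\mapsto -x$. Graph notions (order, bipartite, induced subgraph, maximum degree $\Delta$) refer to the underlying graph $G$. A signed bipartite graph $\Gamma_1$ of order $n$ is taken with a fixed bipartition $(V_1,V_2)$, $|V_1|=s$ (unique up to interchanging the classes when the graph is connected); it is balanced if $|V_1|=|V_2|$. Labeling the vertices of $V_1$ first, $A(\Gamma_1)=\begin{bmatrix}O_s&P\\P^T&O_{n-s}\end{bmatrix}$.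 For a signed graph $\Gamma_2$ of order $m$, the signed Cartesian product $\Gamma_1\widetilde{\Box}\Gamma_2$ and the signed semi-strong product $\Gamma_1\widetilde{\bowtie}\Gamma_2$ are the signed graphs on $V(G_1)\times V(G_2)$ with adjacency matrices $$A(\Gamma_1\widetilde{\Box}\Gamma_2)=A(\Gamma_1)\otimes I_m+\begin{bmatrix}I_s&O\\O&-I_{n-s}\end{bmatrix}\otimes A(\Gamma_2),\qquad A(\Gamma_1\widetilde{\bowtie}\Gamma_2)=\begin{bmatrix}I_s&P\\P^T&-I_{n-s}\end{bmatrix}\otimes A(\Gamma_2),$$ where $\otimes$ is the Kronecker product. *)

theory Defs
  imports "HOL-Analysis.Analysis" "HOL-Computational_Algebra.Computational_Algebra"
begin

section \<open>Signed graphs\<close>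

text \<open>
  An edge is a two-element set of vertices, and only the values of the sign function on the
  edges matter. The vertex set is a component of the record, rather than always the whole vertex
  type, so that an induced subgraph is an object of the same type as the ambient graph.
\<close>

record 'v sgraph =
  verts :: "'v set"
  edges :: "'v set set"
  sign :: "'v set \<Rightarrow> real"

definition signed_graph :: "'v sgraph \<Rightarrow> bool" where
  "signed_graph \<Gamma> \<longleftrightarrow> finite (verts \<Gamma>) \<and>
     (\<forall>e \<in> edges \<Gamma>. e \<subseteq> verts \<Gamma> \<and> card e = 2) \<and>
     (\<forall>e \<in> edges \<Gamma>. sign \<Gamma> e \<in> {1, -1})"

definition graph_order :: "'v sgraph \<Rightarrow> nat" where
  "graph_order \<Gamma> = card (verts \<Gamma>)"

definition vdegree :: "'v sgraph \<Rightarrow> 'v \<Rightarrow> nat" where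
  "vdegree \<Gamma> u = card {v. {u, v} \<in> edges \<Gamma>}"

definition max_degree :: "'v sgraph \<Rightarrow> nat" where
  "max_degree \<Gamma> = Max (vdegree \<Gamma> ` verts \<Gamma>)"

definition induced_sgraph :: "'v sgraph \<Rightarrow> 'v sgraph \<Rightarrow> bool" where
  "induced_sgraph H \<Gamma> \<longleftrightarrow> verts H \<subseteq> verts \<Gamma> \<and>
     edges H = {e \<in> edges \<Gamma>. e \<subseteq> verts H} \<and>
     (\<forall>e \<in> edges H. sign H e = sign \<Gamma> e)"

text \<open>
  Neither class of a bipartition is required to be nonempty, so that the graph of order one is
  bipartite.
\<close>

definition bipartition :: "'v sgraph \<Rightarrow> 'v set \<Rightarrow> 'v set \<Rightarrow> bool" where
  "bipartition \<Gamma> V\<^sub>1 V\<^sub>2 \<longleftrightarrow> V\<^sub>1 \<union> V\<^sub>2 = verts \<Gamma> \<and> V\<^sub>1 \<inter> V\<^sub>2 = {} \<and>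
     (\<forall>e \<in> edges \<Gamma>. \<exists>u \<in> V\<^sub>1. \<exists>v \<in> V\<^sub>2. e = {u, v})"

text \<open>
  The matrix type is indexed by a whole type, so this is the adjacency matrix of a graph with
  vertex set \<open>UNIV\<close>.
\<close>

definition adj :: "('v::finite) sgraph \<Rightarrow> real ^ 'v ^ 'v" where
  "adj \<Gamma> = (\<chi> u v. if {u, v} \<in> edges \<Gamma> then sign \<Gamma> {u, v} else 0)"


section \<open>Eigenvalues\<close>

definition eigenvalue :: "real ^ 'n ^ 'n \<Rightarrow> real \<Rightarrow> bool" where
  "eigenvalue A k \<longleftrightarrow> (\<exists>x. x \<noteq> 0 \<and> A *v x = k *\<^sub>R x)"

definition is_min_eigenvalue :: "real ^ 'n ^ 'n \<Rightarrow> real \<Rightarrow> bool" where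
  "is_min_eigenvalue A k \<longleftrightarrow> eigenvalue A k \<and> (\<forall>l. eigenvalue A l \<longrightarrow> k \<le> l)"

definition charpoly :: "real ^ 'n ^ 'n \<Rightarrow> real poly" where
  "charpoly A = det (\<chi> i j. (if i = j then [:0, 1:] else 0) - [:A $ i $ j:])"

text \<open>The real eigenvalues with their algebraic multiplicities.\<close>

definition spectrum :: "real ^ 'n ^ 'n \<Rightarrow> real multiset" where
  "spectrum A = proots (charpoly A)"

definition symmetric_spectrum :: "real ^ 'n ^ 'n \<Rightarrow> bool" where
  "symmetric_spectrum A \<longleftrightarrow> image_mset uminus (spectrum A) = spectrum A"


section \<open>Signed products\<close>

definition kron :: "real ^ 'a ^ 'a \<Rightarrow> real ^ 'b ^ 'b \<Rightarrow> real ^ ('a \<times> 'b) ^ ('a \<times> 'b)" where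
  "kron A B = (\<chi> p q. A $ fst p $ fst q * B $ snd p $ snd q)"

text \<open>
  The matrix that is \<open>I\<close> on the block of the class \<open>V\<^sub>1\<close>, \<open>-I\<close> on the block of the other class
  and \<open>O\<close> elsewhere.
\<close>

definition class_sign :: "'v set \<Rightarrow> real ^ 'v ^ 'v" where
  "class_sign V\<^sub>1 = (\<chi> u v. if u = v then (if u \<in> V\<^sub>1 then 1 else -1) else 0)"

definition cartesian_matrix ::
  "('a::finite) set \<Rightarrow> 'a sgraph \<Rightarrow> ('b::finite) sgraph \<Rightarrow> real ^ ('a \<times> 'b) ^ ('a \<times> 'b)" where
  "cartesian_matrix V\<^sub>1 \<Gamma>\<^sub>1 \<Gamma>\<^sub>2 = kron (adj \<Gamma>\<^sub>1) (mat 1) + kron (class_sign V\<^sub>1) (adj \<Gamma>\<^sub>2)"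

text \<open>
  As the diagonal blocks of \<open>adj \<Gamma>\<^sub>1\<close> vanish, adding \<open>class_sign V\<^sub>1\<close> fills them with \<open>I\<close> and \<open>-I\<close>.
\<close>

definition semi_strong_matrix ::
  "('a::finite) set \<Rightarrow> 'a sgraph \<Rightarrow> ('b::finite) sgraph \<Rightarrow> real ^ ('a \<times> 'b) ^ ('a \<times> 'b)" where
  "semi_strong_matrix V\<^sub>1 \<Gamma>\<^sub>1 \<Gamma>\<^sub>2 = kron (adj \<Gamma>\<^sub>1 + class_sign V\<^sub>1) (adj \<Gamma>\<^sub>2)"

text \<open>
  The signed graph with a given adjacency matrix. For a symmetric matrix the choice of the ends
  \<open>u\<close> and \<open>v\<close> of \<open>e\<close> does not affect the sign.
\<close>

definition sgraph_of_matrix :: "real ^ ('v::finite) ^ 'v \<Rightarrow> 'v sgraph" where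
  "sgraph_of_matrix M =
     \<lparr>verts = UNIV,
      edges = {{u, v} | u v. M $ u $ v \<noteq> 0},
      sign = (\<lambda>e. SOME r. \<exists>u v. e = {u, v} \<and> r = M $ u $ v)\<rparr>"

definition signed_cartesian ::
  "('a::finite) set \<Rightarrow> 'a sgraph \<Rightarrow> ('b::finite) sgraph \<Rightarrow> ('a \<times> 'b) sgraph" where
  "signed_cartesian V\<^sub>1 \<Gamma>\<^sub>1 \<Gamma>\<^sub>2 = sgraph_of_matrix (cartesian_matrix V\<^sub>1 \<Gamma>\<^sub>1 \<Gamma>\<^sub>2)"

definition signed_semi_strong ::
  "('a::finite) set \<Rightarrow> 'a sgraph \<Rightarrow> ('b::finite) sgraph \<Rightarrow> ('a \<times> 'b) sgraph" where
  "signed_semi_strong V\<^sub>1 \<Gamma>\<^sub>1 \<Gamma>\<^sub>2 = sgraph_of_matrix (semi_strong_matrix V\<^sub>1 \<Gamma>\<^sub>1 \<Gamma>\<^sub>2)"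


section \<open>The definitions fit together\<close>

text \<open>
  The two products are signed graphs with the prescribed adjacency matrices, and the elements of
  the spectrum are the eigenvalues.
\<close>

lemma sgraph_of_matrix_ok:
  fixes M :: "real ^ ('v::finite) ^ 'v"
  assumes sym: "\<And>u v. M $ u $ v = M $ v $ u" and diag: "\<And>u. M $ u $ u = 0"
    and vals: "\<And>u v. M $ u $ v \<in> {0, 1, -1}"
  shows "signed_graph (sgraph_of_matrix M)" and "adj (sgraph_of_matrix M) = M"
proof -
  have sgn: "sign (sgraph_of_matrix M) {u, v} = M $ u $ v" for u v
  proof -
    have "\<exists>u' v'. {u, v} = {u', v'} \<and> sign (sgraph_of_matrix M) {u, v} = M $ u' $ v'"
      unfolding sgraph_of_matrix_def sgraph.simps by (rule someI) blast
    then show ?thesis using sym by (auto simp: doubleton_eq_iff)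
  qed
  have edg: "{u, v} \<in> edges (sgraph_of_matrix M) \<longleftrightarrow> M $ u $ v \<noteq> 0" for u v
    unfolding sgraph_of_matrix_def sgraph.simps using sym by (auto simp: doubleton_eq_iff)
  show "adj (sgraph_of_matrix M) = M"
    by (simp add: adj_def sgn edg vec_eq_iff)
  have "card e = 2 \<and> sign (sgraph_of_matrix M) e \<in> {1, -1}"
    if "e \<in> edges (sgraph_of_matrix M)" for e
  proof -
    obtain u v where e: "e = {u, v}" "M $ u $ v \<noteq> 0"
      using \<open>e \<in> edges (sgraph_of_matrix M)\<close> unfolding sgraph_of_matrix_def sgraph.simps by blast
    then have "u \<noteq> v" using diag by auto
    then show ?thesis using e vals[of u v] by (simp add: sgn)
  qed
  then show "signed_graph (sgraph_of_matrix M)"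
    unfolding signed_graph_def by (simp add: sgraph_of_matrix_def)
qed

lemma adj_facts:
  assumes "signed_graph \<Gamma>"
  shows "adj \<Gamma> $ u $ v = adj \<Gamma> $ v $ u" "adj \<Gamma> $ u $ u = 0" "adj \<Gamma> $ u $ v \<in> {0, 1, -1}"
proof -
  show "adj \<Gamma> $ u $ v = adj \<Gamma> $ v $ u" by (simp add: adj_def insert_commute)
  have "{u} \<notin> edges \<Gamma>" using assms by (force simp: signed_graph_def)
  then show "adj \<Gamma> $ u $ u = 0" by (simp add: adj_def)
  show "adj \<Gamma> $ u $ v \<in> {0, 1, -1}" using assms by (auto simp: adj_def signed_graph_def)
qed

lemma signed_cartesian_ok:
  assumes "signed_graph \<Gamma>\<^sub>1" "signed_graph \<Gamma>\<^sub>2"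
  shows "signed_graph (signed_cartesian V\<^sub>1 \<Gamma>\<^sub>1 \<Gamma>\<^sub>2)"
    and "adj (signed_cartesian V\<^sub>1 \<Gamma>\<^sub>1 \<Gamma>\<^sub>2) = cartesian_matrix V\<^sub>1 \<Gamma>\<^sub>1 \<Gamma>\<^sub>2"
proof -
  let ?M = "cartesian_matrix V\<^sub>1 \<Gamma>\<^sub>1 \<Gamma>\<^sub>2"
  note f1 = adj_facts[OF assms(1)] and f2 = adj_facts[OF assms(2)]
  have s: "?M $ p $ q = ?M $ q $ p" for p q
    using f1(1)[of "fst p" "fst q"] f2(1)[of "snd p" "snd q"]
    by (simp add: cartesian_matrix_def kron_def mat_def class_sign_def)
  have d: "?M $ p $ p = 0" for p
    by (simp add: cartesian_matrix_def kron_def mat_def class_sign_def f1 f2)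
  have v: "?M $ p $ q \<in> {0, 1, -1}" for p q
    using f1(3)[of "fst p" "fst q"] f2(3)[of "snd p" "snd q"] f1(2)[of "fst p"] f2(2)[of "snd p"]
    by (auto simp: cartesian_matrix_def kron_def mat_def class_sign_def)
  show "signed_graph (signed_cartesian V\<^sub>1 \<Gamma>\<^sub>1 \<Gamma>\<^sub>2)" "adj (signed_cartesian V\<^sub>1 \<Gamma>\<^sub>1 \<Gamma>\<^sub>2) = ?M"
    unfolding signed_cartesian_def using sgraph_of_matrix_ok[of ?M, OF s d v] by auto
qed

lemma signed_semi_strong_ok:
  assumes "signed_graph \<Gamma>\<^sub>1" "signed_graph \<Gamma>\<^sub>2"
  shows "signed_graph (signed_semi_strong V\<^sub>1 \<Gamma>\<^sub>1 \<Gamma>\<^sub>2)"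
    and "adj (signed_semi_strong V\<^sub>1 \<Gamma>\<^sub>1 \<Gamma>\<^sub>2) = semi_strong_matrix V\<^sub>1 \<Gamma>\<^sub>1 \<Gamma>\<^sub>2"
proof -
  let ?M = "semi_strong_matrix V\<^sub>1 \<Gamma>\<^sub>1 \<Gamma>\<^sub>2"
  note f1 = adj_facts[OF assms(1)] and f2 = adj_facts[OF assms(2)]
  have s: "?M $ p $ q = ?M $ q $ p" for p q
    using f1(1)[of "fst p" "fst q"] f2(1)[of "snd p" "snd q"]
    by (simp add: semi_strong_matrix_def kron_def class_sign_def)
  have d: "?M $ p $ p = 0" for p
    by (simp add: semi_strong_matrix_def kron_def f2)
  have v: "?M $ p $ q \<in> {0, 1, -1}" for p q
    using f1(3)[of "fst p" "fst q"] f2(3)[of "snd p" "snd q"] f1(2)[of "fst p"]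
    by (auto simp: semi_strong_matrix_def kron_def class_sign_def)
  show "signed_graph (signed_semi_strong V\<^sub>1 \<Gamma>\<^sub>1 \<Gamma>\<^sub>2)" "adj (signed_semi_strong V\<^sub>1 \<Gamma>\<^sub>1 \<Gamma>\<^sub>2) = ?M"
    unfolding signed_semi_strong_def using sgraph_of_matrix_ok[of ?M, OF s d v] by auto
qed

lemma poly_charpoly:
  fixes A :: "real ^ ('n::finite) ^ 'n"
  shows "poly (charpoly A) k = det (mat k - A)"
  unfolding charpoly_def det_def
  by (auto simp: poly_sum poly_prod mat_def intro!: sum.cong prod.cong)

lemma eigenvalue_iff_det:
  fixes A :: "real ^ ('n::finite) ^ 'n"
  shows "eigenvalue A k \<longleftrightarrow> det (mat k - A) = 0"
proof -
  have "mat k *v x = k *\<^sub>R x" for x :: "real ^ 'n"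
    by (simp add: vec_eq_iff mat_def matrix_vector_mult_def if_distrib[of "\<lambda>a. a * _"]
        cong: if_cong)
  then have "(mat k - A) *v x = k *\<^sub>R x - A *v x" for x
    by (simp add: matrix_vector_mult_diff_rdistrib)
  then have "eigenvalue A k \<longleftrightarrow> (\<exists>x. x \<noteq> 0 \<and> (mat k - A) *v x = 0)"
    unfolding eigenvalue_def by auto
  also have "\<dots> \<longleftrightarrow> \<not> (\<exists>B. B ** (mat k - A) = mat 1)"
    using matrix_left_invertible_ker[of "mat k - A"] by blast
  also have "\<dots> \<longleftrightarrow> det (mat k - A) = 0"
    using invertible_det_nz[of "mat k - A"] by (simp add: invertible_left_inverse)
  finally show ?thesis .
qed

lemma charpoly_nonzero:
  fixes A :: "real ^ ('n::finite) ^ 'n"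
  shows "charpoly A \<noteq> 0"
proof
  assume "charpoly A = 0"
  then have "eigenvalue A (onorm ((*v) A) + 1)"
    by (simp add: eigenvalue_iff_det flip: poly_charpoly)
  then obtain x where x: "x \<noteq> 0" "A *v x = (onorm ((*v) A) + 1) *\<^sub>R x"
    by (auto simp: eigenvalue_def)
  have bl: "bounded_linear ((*v) A)" by (rule matrix_vector_mul_bounded_linear)
  have "(onorm ((*v) A) + 1) * norm x \<le> onorm ((*v) A) * norm x"
    using onorm[OF bl, of x] x(2) onorm_pos_le[OF bl] by simp
  then show False using x(1) by (simp add: algebra_simps)
qed

lemma set_spectrum:
  fixes A :: "real ^ ('n::finite) ^ 'n"
  shows "set_mset (spectrum A) = {k. eigenvalue A k}"
  by (simp add: spectrum_def charpoly_nonzero eigenvalue_iff_det poly_charpoly)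

end

theory Submission
  imports Defs
begin

text \<open>
  Write \<open>A\<close>, \<open>B\<close> for the two adjacency matrices and \<open>D\<close> for the class sign matrix. Since the first
  graph is bipartite, \<open>A\<close> anticommutes with \<open>D\<close>, so the square of \<open>A \<otimes> I + D \<otimes> B\<close> is
  \<open>A\<^sup>2 \<otimes> I + I \<otimes> B\<^sup>2\<close> and the square of \<open>(A + D) \<otimes> B\<close> is \<open>(A\<^sup>2 + I) \<otimes> B\<^sup>2\<close>. Hence every eigenvalue of
  the product matrix has absolute value at least the claimed bound \<open>t\<close>. The space therefore
  splits into a subspace where the quadratic form is at least \<open>t\<close> times the squared norm and one
  where it is at most \<open>-t\<close> times it. One of the two has at least half of the dimension, so it
  contains a nonzero vector supported on the vertices of \<open>H\<close>, on which the form is bounded in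
  absolute value by the maximum degree of \<open>H\<close> times the squared norm.
\<close>

unbundle no fps_syntax \<comment> \<open>makes \<open>$\<close> unambiguous\<close>

section \<open>Definite subspaces of a symmetric operator\<close>

text \<open>A zero of a nonnegative quadratic form is a minimum, so the linear term of the form in
  every direction of \<open>W\<close> vanishes there. Otherwise a small move along \<open>w\<close>
  with the right sign would make the form negative.\<close>

lemma psd_form_zero:
  fixes f :: "'a::euclidean_space \<Rightarrow> 'a"
  assumes "linear f" and sym: "\<And>x y. f x \<bullet> y = x \<bullet> f y"
    and "subspace W" "v \<in> W" "w \<in> W"
    and psd: "\<And>y. y \<in> W \<Longrightarrow> 0 \<le> y \<bullet> f y" and "v \<bullet> f v = 0"
  shows "w \<bullet> f v = 0"
proof (rule ccontr)
  assume nz: "w \<bullet> f v \<noteq> 0"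
  let ?a = "w \<bullet> f v" and ?b = "w \<bullet> f w"
  \<comment> \<open>The minimizer of the form on the line is \<open>- ?a / ?b\<close>; the \<open>+ 1\<close> covers \<open>?b = 0\<close>.\<close>
  define t where "t = - ?a / (?b + 1)"
  have b: "0 \<le> ?b" using psd \<open>w \<in> W\<close> by blast
  have "v + t *\<^sub>R w \<in> W"
    using assms by (simp add: subspace_add subspace_scale)
  then have "0 \<le> (v + t *\<^sub>R w) \<bullet> f (v + t *\<^sub>R w)" by (rule psd)
  also have "\<dots> = 2 * t * ?a + t\<^sup>2 * ?b"
    using \<open>v \<bullet> f v = 0\<close> sym[of v w]
    by (simp add: linear_add[OF \<open>linear f\<close>] linear_scale[OF \<open>linear f\<close>] inner_add_left
        inner_add_right power2_eq_square inner_commute algebra_simps)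
  also have "\<dots> = - ?a\<^sup>2 * (?b + 2) / (?b + 1)\<^sup>2"
  proof -
    have "2 * (- a / s) * a + (- a / s)\<^sup>2 * (s - 1) = - a\<^sup>2 * (s + 1) / s\<^sup>2" if "s > 0" for a s :: real
      using that by (simp add: field_simps power2_eq_square)
    from this[of "?b + 1" ?a] show ?thesis using b by (simp add: t_def add.assoc)
  qed
  also have "\<dots> < 0" using b nz by (intro divide_neg_pos mult_neg_pos) auto
  finally show False by simp
qed

text \<open>By compactness the form attains its minimum \<open>c\<close> on the unit sphere of
  \<open>W\<close>, at some \<open>v\<close>. The form of \<open>f\<close> minus \<open>c\<close>
  times the identity is then nonnegative on \<open>W\<close> and zero at \<open>v\<close>, which
  forces the eigenvector equation.\<close>

lemma least_eigenvector:
  fixes f :: "'a::euclidean_space \<Rightarrow> 'a"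
  assumes "linear f" and sym: "\<And>x y. f x \<bullet> y = x \<bullet> f y"
    and W: "subspace W" "W \<noteq> {0}" and inv: "f ` W \<subseteq> W"
  obtains v c where "v \<in> W" "norm v = 1" "f v = c *\<^sub>R v" "\<And>y. y \<in> W \<Longrightarrow> c * (y \<bullet> y) \<le> y \<bullet> f y"
proof -
  let ?S = "W \<inter> sphere 0 1"
  have normalize: "(1 / norm y) *\<^sub>R y \<in> ?S" if "y \<in> W" "y \<noteq> 0" for y
    using that W(1) by (simp add: subspace_scale)
  have "0 \<in> W" using W(1) by (rule subspace_0)
  then obtain z where "z \<in> W" "z \<noteq> 0" using W(2) by auto
  then have ne: "?S \<noteq> {}" using normalize by blast
  have cpt: "compact ?S"
    by (rule closed_Int_compact[OF closed_subspace[OF W(1)] compact_sphere])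
  have cont: "continuous_on ?S (\<lambda>y. y \<bullet> f y)"
    by (intro continuous_on_inner continuous_on_id
        linear_continuous_on[OF \<open>linear f\<close>[unfolded linear_conv_bounded_linear]])
  obtain v where v: "v \<in> ?S" and min: "\<And>y. y \<in> ?S \<Longrightarrow> v \<bullet> f v \<le> y \<bullet> f y"
    using continuous_attains_inf[OF cpt ne cont] by auto
  define c where "c = v \<bullet> f v"
  have vW: "v \<in> W" and nv: "norm v = 1" using v by auto
  have low: "c * (y \<bullet> y) \<le> y \<bullet> f y" if "y \<in> W" for y
  proof (cases "y = 0")
    case False
    then have "c \<le> ((1 / norm y) *\<^sub>R y) \<bullet> f ((1 / norm y) *\<^sub>R y)"
      using min[OF normalize[OF that False]] c_def by simp
    also have "\<dots> = (y \<bullet> f y) / (y \<bullet> y)"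
      by (simp add: linear_scale[OF \<open>linear f\<close>] dot_square_norm power2_eq_square)
    finally show ?thesis using False by (simp add: field_simps)
  qed simp
  define g where "g y = f y - c *\<^sub>R y" for y
  have lg: "linear g"
    unfolding g_def
    using \<open>linear f\<close> by (intro linear_compose_sub linear_compose_scale_right linear_id[unfolded id_def]) auto
  have gv: "g v \<in> W"
    unfolding g_def using inv vW W(1) by (auto intro!: subspace_diff subspace_scale)
  \<comment> \<open>By invariance \<open>g v\<close> lies in \<open>W\<close>, so it may serve as
    its own test direction.\<close>
  have "g v \<bullet> g v = 0"
  proof (rule psd_form_zero[OF lg _ W(1) vW gv])
    show "g x \<bullet> y = x \<bullet> g y" for x y
      unfolding g_def by (simp add: inner_diff sym)
    show "0 \<le> y \<bullet> g y" if "y \<in> W" for y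
      using low[OF that] by (simp add: g_def inner_diff)
    show "v \<bullet> g v = 0"
      using nv by (simp add: g_def inner_diff c_def dot_square_norm)
  qed
  then have "f v = c *\<^sub>R v" by (simp add: g_def)
  then show thesis using that vW nv low by blast
qed

text \<open>An eigenvector orthogonal to \<open>P\<close> gives no cross terms:
  \<open>v \<bullet> f y\<close> equals \<open>c * (v \<bullet> y) = 0\<close> for \<open>y\<close>
  in \<open>P\<close>, so both the form and the squared norm split as sums. Serves below for
  \<open>f\<close> and for its negative.\<close>

lemma definite_extension:
  fixes f :: "'a::euclidean_space \<Rightarrow> 'a"
  assumes "linear f" and sym: "\<And>x y. f x \<bullet> y = x \<bullet> f y"
    and P: "subspace P" "\<And>x. x \<in> P \<Longrightarrow> t * (x \<bullet> x) \<le> x \<bullet> f x" "\<And>x. x \<in> P \<Longrightarrow> v \<bullet> x = 0"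
    and v: "norm v = 1" "f v = c *\<^sub>R v" "t \<le> c"
  shows "dim (span (insert v P)) = Suc (dim P)"
    and "\<And>x. x \<in> span (insert v P) \<Longrightarrow> t * (x \<bullet> x) \<le> x \<bullet> f x"
proof -
  have vv: "v \<bullet> v = 1" using v(1) by (simp add: dot_square_norm)
  have spP: "span P = P" using P(1) by (simp add: span_eq_iff)
  have "v \<notin> span P" using P(3) vv spP by (metis zero_neq_one)
  then show "dim (span (insert v P)) = Suc (dim P)" by (simp add: dim_insert)
  fix x assume "x \<in> span (insert v P)"
  then obtain k where k: "x - k *\<^sub>R v \<in> P"
    using spP by (auto simp: span_breakdown_eq)
  define y where "y = x - k *\<^sub>R v"
  have yP: "y \<in> P" and x: "x = y + k *\<^sub>R v" using k by (auto simp: y_def)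
  have vy: "v \<bullet> y = 0" "y \<bullet> v = 0" using P(3)[OF yP] by (auto simp: inner_commute)
  have "v \<bullet> f y = 0" using sym[of v y] v(2) vy by simp
  then have fx: "x \<bullet> f x = y \<bullet> f y + k\<^sup>2 * c"
    using vv vy v(2)
    by (simp add: x linear_add[OF \<open>linear f\<close>] linear_scale[OF \<open>linear f\<close>] inner_add_left
        inner_add_right power2_eq_square)
  have xx: "x \<bullet> x = y \<bullet> y + k\<^sup>2"
    using vv vy by (simp add: x inner_add_left inner_add_right power2_eq_square)
  show "t * (x \<bullet> x) \<le> x \<bullet> f x"
    unfolding fx xx using P(2)[OF yP] mult_left_mono[OF v(3), of "k\<^sup>2"]
    by (simp add: algebra_simps)
qed

text \<open>Induction on the dimension: an eigenvector \<open>v\<close> is split off, and its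
  orthogonal complement in \<open>W\<close> is again invariant. The norm bound at \<open>v\<close>
  gives \<open>t \<le> \<bar>c\<bar>\<close>, and the sign of \<open>c\<close> decides which of the
  two subspaces of the complement receives \<open>v\<close>.\<close>

lemma definite_splitting:
  fixes f :: "'a::euclidean_space \<Rightarrow> 'a"
  assumes "linear f" and sym: "\<And>x y. f x \<bullet> y = x \<bullet> f y"
    and "subspace W" "f ` W \<subseteq> W" and "\<And>x. x \<in> W \<Longrightarrow> t * norm x \<le> norm (f x)"
  shows "\<exists>P Q. subspace P \<and> subspace Q \<and> P \<subseteq> W \<and> Q \<subseteq> W \<and> dim P + dim Q = dim W \<and>
    (\<forall>x\<in>P. t * (x \<bullet> x) \<le> x \<bullet> f x) \<and> (\<forall>x\<in>Q. t * (x \<bullet> x) \<le> x \<bullet> - f x)"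
  using assms(3-5)
proof (induction "dim W" arbitrary: W)
  case 0
  then have "W = {0}" using subspace_0[of W] by (auto simp: dim_eq_0)
  then show ?case by (intro exI[of _ "{0}"]) auto
next
  case (Suc d)
  have ne: "W \<noteq> {0}" using Suc.hyps(2) by force
  obtain v c where v: "v \<in> W" "norm v = 1" "f v = c *\<^sub>R v"
    by (rule least_eigenvector[OF \<open>linear f\<close> sym Suc.prems(1) ne Suc.prems(2)])
  have "t * norm v \<le> norm (f v)" by (rule Suc.prems(3)[OF v(1)])
  then have tc: "t \<le> \<bar>c\<bar>" using v(2,3) by simp
  define U where "U = {y \<in> W. v \<bullet> y = 0}"
  have U: "subspace U"
    using Suc.prems(1) by (auto simp: U_def subspace_def inner_add_right)
  have "dim {y \<in> W. \<forall>x\<in>span {v}. orthogonal x y} + dim (span {v}) = dim W"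
    using Suc.prems(1) v(1) by (intro dim_subspace_orthogonal_to_vectors) (auto simp: span_minimal)
  moreover have "{y \<in> W. \<forall>x\<in>span {v}. orthogonal x y} = U"
    by (auto simp: U_def orthogonal_def span_singleton)
  moreover have "v \<noteq> 0" using v(2) by auto
  ultimately have dU: "d = dim U" using Suc.hyps(2) by (simp add: dim_singleton)
  have "f ` U \<subseteq> U"
  proof
    fix z assume "z \<in> f ` U"
    then obtain y where y: "z = f y" "y \<in> W" "v \<bullet> y = 0" by (auto simp: U_def)
    have "v \<bullet> f y = 0" using sym[of v y] v(3) y(3) by simp
    then show "z \<in> U" using y Suc.prems(2) by (auto simp: U_def)
  qed
  moreover have "t * norm x \<le> norm (f x)" if "x \<in> U" for x
    using that Suc.prems(3) by (simp add: U_def)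
  ultimately obtain P Q where PQ: "subspace P" "subspace Q" "P \<subseteq> U" "Q \<subseteq> U" "dim P + dim Q = d"
    "\<And>x. x \<in> P \<Longrightarrow> t * (x \<bullet> x) \<le> x \<bullet> f x" "\<And>x. x \<in> Q \<Longrightarrow> t * (x \<bullet> x) \<le> x \<bullet> - f x"
    using Suc.hyps(1)[OF dU U] dU by metis
  have ortho: "v \<bullet> x = 0" if "x \<in> P \<or> x \<in> Q" for x using that PQ(3,4) by (auto simp: U_def)
  have sub: "span (insert v X) \<subseteq> W" if "X \<subseteq> U" for X
    using that v(1) Suc.prems(1) by (intro span_minimal) (auto simp: U_def)
  have PQW: "P \<subseteq> W" "Q \<subseteq> W" using PQ(3,4) by (auto simp: U_def)
  show ?case
  proof (cases "0 \<le> c")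
    case True
    then have "t \<le> c" using tc by simp
    note ext = definite_extension[OF \<open>linear f\<close> sym PQ(1) PQ(6) ortho v(2) v(3) this, simplified]
    show ?thesis
      using ext PQ PQW sub[OF PQ(3)] Suc.hyps(2)
      by (intro exI[of _ "span (insert v P)"] exI[of _ Q]) auto
  next
    case False
    \<comment> \<open>The negative case is the extension step for the negated operator, of which
      \<open>v\<close> is an eigenvector for \<open>- c\<close>.\<close>
    then have "t \<le> - c" using tc by simp
    have "linear (\<lambda>x. - f x)" using \<open>linear f\<close> by (rule linear_compose_neg)
    note ext = definite_extension[OF this _ PQ(2) PQ(7) ortho v(2) _ \<open>t \<le> - c\<close>, simplified, OF sym]
    show ?thesis
      using ext PQ PQW sub[OF PQ(4)] Suc.hyps(2) v(3)
      by (intro exI[of _ P] exI[of _ "span (insert v Q)"]) auto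
  qed
qed

section \<open>Quadratic forms on induced subgraphs\<close>

text \<open>A dimension count that takes the place of eigenvalue interlacing: the vectors supported
  on \<open>S\<close> fill more than half of the space, so they meet the larger of the two definite
  subspaces nontrivially.\<close>

lemma supported_definite_vector:
  fixes M :: "real ^ ('n::finite) ^ 'n"
  assumes sym: "transpose M = M" and exp: "\<And>x. t * norm x \<le> norm (M *v x)"
    and S: "CARD('n) < 2 * card S"
  obtains x :: "real ^ 'n" where "x \<noteq> 0" "\<And>i. i \<notin> S \<Longrightarrow> x $ i = 0" "t * (x \<bullet> x) \<le> \<bar>x \<bullet> (M *v x)\<bar>"
proof -
  have "(M *v x) \<bullet> y = x \<bullet> (M *v y)" for x y
    by (metis dot_lmul_matrix sym transpose_matrix_vector)
  then obtain P Q where PQ: "subspace P" "subspace Q" "dim P + dim Q = CARD('n)"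
    "\<forall>x\<in>P. t * (x \<bullet> x) \<le> x \<bullet> (M *v x)" "\<forall>x\<in>Q. t * (x \<bullet> x) \<le> x \<bullet> - (M *v x)"
    using definite_splitting[of "(*v) M" UNIV t] exp by auto
  define E where "E = {x :: real ^ 'n. \<forall>i. i \<notin> S \<longrightarrow> x $ i = 0}"
  have E: "subspace E" by (auto simp: E_def subspace_def)
  have dE: "dim E = card S"
    using dim_substandard_cart[of S, where 'a=real] by (simp add: E_def dim_vec_eq)
  have meet: "\<exists>x. x \<noteq> 0 \<and> x \<in> R \<and> x \<in> E" if "subspace R" "CARD('n) < dim R + card S" for R
  proof (rule ccontr)
    assume "\<not> ?thesis"
    then have "R \<inter> E = {0}" using subspace_0[OF that(1)] subspace_0[OF E] by auto
    then have "dim {x + y |x y. x \<in> R \<and> y \<in> E} = dim R + dim E"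
      using dim_sums_Int[OF that(1) E] by simp
    then show False using that(2) dE dim_subset_UNIV_cart[of "{x + y |x y. x \<in> R \<and> y \<in> E}"] by simp
  qed
  \<comment> \<open>If both inequalities failed, adding them would give
    \<open>CARD('n) + 2 * card S \<le> 2 * CARD('n)\<close>.\<close>
  have "CARD('n) < dim P + card S \<or> CARD('n) < dim Q + card S" using PQ(3) S by linarith
  then obtain x where "x \<noteq> 0" "x \<in> P \<or> x \<in> Q" "x \<in> E" using meet PQ(1,2) by blast
  then show thesis using that[of x] PQ(4,5) by (force simp: E_def)
qed

text \<open>For symmetric \<open>A\<close> the form of \<open>A ** A\<close> at \<open>x\<close> is
  the squared norm of \<open>A *v x\<close>, and its minimum on the unit sphere is an eigenvalue of
  \<open>A ** A\<close>. Only the square of \<open>l\<close> is given, hence the absolute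
  value.\<close>

lemma expansion_from_min_eigenvalue:
  fixes A :: "real ^ ('n::finite) ^ 'n"
  assumes sym: "transpose A = A" and min: "is_min_eigenvalue (A ** A) (l\<^sup>2)"
  shows "\<bar>l\<bar> * norm x \<le> norm (A *v x)"
proof -
  have symA: "(A *v x) \<bullet> y = x \<bullet> (A *v y)" for x y
    by (metis dot_lmul_matrix sym transpose_matrix_vector)
  let ?f = "\<lambda>x. A *v (A *v x)"
  have lin: "linear ?f"
    using matrix_vector_mul_linear[of "A ** A"] by (simp add: matrix_vector_mul_assoc)
  have symf: "?f x \<bullet> y = x \<bullet> ?f y" for x y by (simp add: symA)
  have ne: "(UNIV :: (real ^ 'n) set) \<noteq> {0}" by (rule UNIV_not_singleton)
  obtain v c where v: "norm v = 1" "?f v = c *\<^sub>R v" "\<And>y. c * (y \<bullet> y) \<le> y \<bullet> ?f y"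
    by (rule least_eigenvector[OF lin symf subspace_UNIV ne subset_UNIV]) (rule that; simp)
  have "eigenvalue (A ** A) c"
    unfolding eigenvalue_def using v(1,2)
    by (intro exI[of _ v]) (auto simp: matrix_vector_mul_assoc)
  then have "l\<^sup>2 \<le> c" using min by (simp add: is_min_eigenvalue_def)
  then have "l\<^sup>2 * (x \<bullet> x) \<le> c * (x \<bullet> x)" by (simp add: mult_right_mono)
  also have "\<dots> \<le> (A *v x) \<bullet> (A *v x)" using v(3)[of x] by (simp add: symA)
  finally show ?thesis
    by (intro power2_le_imp_le[of "\<bar>l\<bar> * norm x"])
      (simp_all only: power_mult_distrib power2_norm_eq_inner power2_abs norm_ge_zero)
qed

text \<open>On a vector supported on the vertices of \<open>H\<close> the form is at least
  \<open>t\<close> times the squared norm in absolute value. It is also at most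
  \<open>max_degree H\<close> times it, since the absolute row sums of the adjacency matrix over
  these vertices are the degrees in \<open>H\<close>.\<close>

lemma max_degree_ge_of_expansion:
  fixes \<Gamma> H :: "('v::finite) sgraph"
  assumes \<Gamma>: "signed_graph \<Gamma>" and H: "induced_sgraph H \<Gamma>" "graph_order H = CARD('v) div 2 + 1"
    and exp: "\<And>x. t * norm x \<le> norm (adj \<Gamma> *v x)"
  shows "t \<le> real (max_degree H)"
proof -
  let ?S = "verts H" and ?M = "adj \<Gamma>"
  note adj = adj_facts[OF \<Gamma>]
  have "transpose ?M = ?M" by (simp add: transpose_def vec_eq_iff adj(1))
  moreover have "CARD('v) < 2 * card ?S" using H(2) by (simp add: graph_order_def)
  ultimately obtain x :: "real ^ 'v" where x: "x \<noteq> 0" "\<And>i. i \<notin> ?S \<Longrightarrow> x $ i = 0"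
    "t * (x \<bullet> x) \<le> \<bar>x \<bullet> (?M *v x)\<bar>"
    using supported_definite_vector[of ?M t ?S] exp by metis
  define e where "e u v = \<bar>?M $ u $ v\<bar>" for u v
  have e_sym: "e u v = e v u" for u v using adj(1) by (simp add: e_def)
  have deg: "(\<Sum>v\<in>?S. e u v) \<le> real (max_degree H)" if "u \<in> ?S" for u
  proof -
    have "(\<Sum>v\<in>?S. e u v) = (\<Sum>v\<in>?S. if {u, v} \<in> edges \<Gamma> then 1 else 0)"
      using \<Gamma> by (intro sum.cong) (auto simp: e_def adj_def signed_graph_def)
    also have "\<dots> = real (card {v \<in> ?S. {u, v} \<in> edges \<Gamma>})"
      by (simp add: sum.If_cases Int_def)
    \<comment> \<open>As \<open>H\<close> is induced, its edges at \<open>u\<close> are exactly the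
      edges of the ambient graph whose other end lies in \<open>?S\<close>.\<close>
    also have "{v \<in> ?S. {u, v} \<in> edges \<Gamma>} = {v. {u, v} \<in> edges H}"
      using H(1) that by (auto simp: induced_sgraph_def)
    also have "card \<dots> \<le> max_degree H"
      unfolding max_degree_def vdegree_def[symmetric] using that by (intro Max_ge) auto
    finally show ?thesis by simp
  qed
  have "t * (x \<bullet> x) \<le> \<bar>\<Sum>u\<in>UNIV. \<Sum>v\<in>UNIV. x $ u * ?M $ u $ v * x $ v\<bar>"
    using x(3) by (simp add: inner_vec_def matrix_vector_mult_def sum_distrib_left mult.assoc)
  also have "(\<Sum>u\<in>UNIV. \<Sum>v\<in>UNIV. x $ u * ?M $ u $ v * x $ v) =
      (\<Sum>u\<in>?S. \<Sum>v\<in>?S. x $ u * ?M $ u $ v * x $ v)"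
    using x(2) by (intro sum.mono_neutral_cong_right) (auto intro!: sum.mono_neutral_right)
  \<comment> \<open>Each product of two entries is replaced by the mean of their squares, so that
    the sum can be organised by rows.\<close>
  also have "\<bar>\<dots>\<bar> \<le> (\<Sum>u\<in>?S. \<Sum>v\<in>?S. e u v * ((x $ u)\<^sup>2 + (x $ v)\<^sup>2) / 2)"
  proof (rule order_trans[OF sum_abs sum_mono], rule order_trans[OF sum_abs sum_mono])
    fix u v
    have "2 * (\<bar>x $ u\<bar> * \<bar>x $ v\<bar>) \<le> (x $ u)\<^sup>2 + (x $ v)\<^sup>2"
      using sum_squares_bound[of "\<bar>x $ u\<bar>" "\<bar>x $ v\<bar>"] by simp
    then have "e u v * (\<bar>x $ u\<bar> * \<bar>x $ v\<bar>) \<le> e u v * (((x $ u)\<^sup>2 + (x $ v)\<^sup>2) / 2)"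
      by (intro mult_left_mono) (auto simp: e_def)
    then show "\<bar>x $ u * ?M $ u $ v * x $ v\<bar> \<le> e u v * ((x $ u)\<^sup>2 + (x $ v)\<^sup>2) / 2"
      by (simp add: e_def abs_mult mult_ac)
  qed
  \<comment> \<open>The two halves of the sum agree, as \<open>e\<close> is symmetric.\<close>
  also have "\<dots> = (\<Sum>u\<in>?S. \<Sum>v\<in>?S. e u v * (x $ u)\<^sup>2)"
  proof -
    have "(\<Sum>u\<in>?S. \<Sum>v\<in>?S. e u v * (x $ v)\<^sup>2) = (\<Sum>u\<in>?S. \<Sum>v\<in>?S. e u v * (x $ u)\<^sup>2)"
      by (subst sum.swap) (simp add: e_sym)
    then show ?thesis
      by (simp add: distrib_left add_divide_distrib sum.distrib flip: sum_divide_distrib)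
  qed
  also have "\<dots> \<le> (\<Sum>u\<in>?S. real (max_degree H) * (x $ u)\<^sup>2)"
    using deg by (intro sum_mono) (simp add: mult_right_mono flip: sum_distrib_right)
  also have "\<dots> \<le> (\<Sum>u\<in>UNIV. real (max_degree H) * (x $ u)\<^sup>2)"
    by (intro sum_mono2) auto
  also have "\<dots> = real (max_degree H) * (x \<bullet> x)"
    by (simp add: inner_vec_def power2_eq_square sum_distrib_left)
  finally show ?thesis using x(1) by simp
qed

section \<open>Kronecker products\<close>

lemma kron_mult: "kron A B ** kron C D = kron (A ** C) (B ** D)"
  by (simp add: kron_def matrix_matrix_mult_def vec_eq_iff sum_product mult_ac
      sum.cartesian_product case_prod_beta)

lemma transpose_kron: "transpose (kron A B) = kron (transpose A) (transpose B)"
  by (simp add: kron_def transpose_def vec_eq_iff)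

lemma norm_vec_prod:
  fixes x :: "real ^ ('a::finite \<times> 'b::finite)"
  shows "(norm x)\<^sup>2 = (\<Sum>a\<in>UNIV. \<Sum>b\<in>UNIV. (x $ (a, b))\<^sup>2)"
  unfolding power2_norm_eq_inner
  by (simp add: inner_vec_def power2_eq_square sum.cartesian_product case_prod_beta)

lemma kron_vector:
  "(kron A B *v x) $ (a, b) = (\<Sum>i\<in>UNIV. \<Sum>j\<in>UNIV. A $ a $ i * B $ b $ j * x $ (i, j))"
  by (simp add: kron_def matrix_vector_mult_def sum.cartesian_product case_prod_beta)

lemma kron_mat_1_right_vector:
  "(kron A (mat 1) *v x) $ (a, b) = (A *v (\<chi> i. x $ (i, b))) $ a"
proof -
  have "A $ a $ i * mat 1 $ b $ j * x $ (i, j) = (if b = j then A $ a $ i * x $ (i, j) else 0)" for i j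
    by (simp add: mat_def)
  then show ?thesis unfolding kron_vector by (simp add: matrix_vector_mult_def)
qed

lemma kron_mat_1_left_vector:
  "(kron (mat 1) A *v x) $ (a, b) = (A *v (\<chi> j. x $ (a, j))) $ b"
proof -
  have "(\<Sum>j\<in>UNIV. mat 1 $ a $ i * A $ b $ j * x $ (i, j)) =
      (if a = i then \<Sum>j\<in>UNIV. A $ b $ j * x $ (i, j) else 0)" for i
    by (simp add: mat_def)
  then show ?thesis unfolding kron_vector by (simp add: matrix_vector_mult_def)
qed

text \<open>The product factors as \<open>kron A (mat 1) ** kron (mat 1) B\<close>. Each factor
  applies \<open>A\<close> or \<open>B\<close> separately to the slices of \<open>x\<close> in one
  coordinate, and squared norms add up over slices, so each factor inherits its lower bound.\<close>

lemma kron_expansion: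
  fixes A :: "real ^ ('a::finite) ^ 'a" and B :: "real ^ ('b::finite) ^ 'b"
  assumes A: "\<And>x. s * norm x \<le> norm (A *v x)" and B: "\<And>x. t * norm x \<le> norm (B *v x)"
    and st: "0 \<le> s" "0 \<le> t"
  shows "s * t * norm x \<le> norm (kron A B *v x)"
proof -
  have nv: "(norm y)\<^sup>2 = (\<Sum>i\<in>UNIV. (y $ i)\<^sup>2)" for y :: "real ^ ('c::finite)"
    unfolding power2_norm_eq_inner by (simp add: inner_vec_def power2_eq_square)
  have sq: "c\<^sup>2 * (\<Sum>i\<in>UNIV. (y $ i)\<^sup>2) \<le> (\<Sum>i\<in>UNIV. ((C *v y) $ i)\<^sup>2)"
    if "c * norm y \<le> norm (C *v y)" "0 \<le> c" for c y and C :: "real ^ ('c::finite) ^ 'c"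
    using power_mono[OF that(1), of 2] that(2) by (simp add: power_mult_distrib nv)
  have left: "s * norm x \<le> norm (kron A (mat 1) *v x)" for x :: "real ^ ('a \<times> 'b)"
  proof (rule power2_le_imp_le)
    have "(s * norm x)\<^sup>2 = (\<Sum>b\<in>UNIV. s\<^sup>2 * (\<Sum>a\<in>UNIV. (x $ (a, b))\<^sup>2))"
      unfolding power_mult_distrib norm_vec_prod by (subst sum.swap) (simp add: sum_distrib_left)
    also have "\<dots> \<le> (\<Sum>b\<in>UNIV. \<Sum>a\<in>UNIV. ((A *v (\<chi> i. x $ (i, b))) $ a)\<^sup>2)"
      using sq[OF A st(1), of "\<chi> i. x $ (i, b)" for b] by (intro sum_mono) simp
    also have "\<dots> = (norm (kron A (mat 1) *v x))\<^sup>2"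
      unfolding norm_vec_prod kron_mat_1_right_vector by (rule sum.swap)
    finally show "(s * norm x)\<^sup>2 \<le> (norm (kron A (mat 1) *v x))\<^sup>2" .
  qed simp
  have right: "t * norm x \<le> norm (kron (mat 1) B *v x)" for x :: "real ^ ('a \<times> 'b)"
  proof (rule power2_le_imp_le)
    have "(t * norm x)\<^sup>2 = (\<Sum>a\<in>UNIV. t\<^sup>2 * (\<Sum>b\<in>UNIV. (x $ (a, b))\<^sup>2))"
      unfolding power_mult_distrib norm_vec_prod by (simp add: sum_distrib_left)
    also have "\<dots> \<le> (\<Sum>a\<in>UNIV. \<Sum>b\<in>UNIV. ((B *v (\<chi> j. x $ (a, j))) $ b)\<^sup>2)"
      using sq[OF B st(2), of "\<chi> j. x $ (a, j)" for a] by (intro sum_mono) simp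
    also have "\<dots> = (norm (kron (mat 1) B *v x))\<^sup>2"
      unfolding norm_vec_prod kron_mat_1_left_vector ..
    finally show "(t * norm x)\<^sup>2 \<le> (norm (kron (mat 1) B *v x))\<^sup>2" .
  qed simp
  have "s * (t * norm x) \<le> s * norm (kron (mat 1) B *v x)"
    by (rule mult_left_mono[OF right st(1)])
  also have "\<dots> \<le> norm (kron A (mat 1) *v (kron (mat 1) B *v x))" by (rule left)
  also have "\<dots> = norm (kron A B *v x)" by (simp add: matrix_vector_mul_assoc kron_mult)
  finally show ?thesis by (simp add: mult.assoc)
qed

section \<open>Sums of anticommuting symmetric matrices\<close>

text \<open>The inner product of \<open>A *v x\<close> and \<open>B *v x\<close> is the form of
  \<open>A ** B\<close> as well as that of \<open>B ** A\<close>. These are opposite, so the two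
  vectors are orthogonal.\<close>

lemma anticommuting_pythagoras:
  fixes A B :: "real ^ ('n::finite) ^ 'n"
  assumes A: "transpose A = A" and B: "transpose B = B" and anti: "A ** B = - (B ** A)"
  shows "(norm ((A + B) *v x))\<^sup>2 = (norm (A *v x))\<^sup>2 + (norm (B *v x))\<^sup>2"
proof -
  have move: "(C *v y) \<bullet> z = y \<bullet> (C *v z)" if "transpose C = C" for C :: "real ^ 'n ^ 'n" and y z
    by (metis dot_lmul_matrix that transpose_matrix_vector)
  have "(A *v x) \<bullet> (B *v x) = x \<bullet> ((A ** B) *v x)"
    by (simp add: move[OF A] matrix_vector_mul_assoc)
  moreover have "(A *v x) \<bullet> (B *v x) = x \<bullet> ((B ** A) *v x)"
    by (simp add: inner_commute[of "A *v x"] move[OF B] matrix_vector_mul_assoc)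
  moreover have "(- (B ** A)) *v x = - ((B ** A) *v x)"
    by (simp add: matrix_vector_mult_def vec_eq_iff sum_negf)
  ultimately have "(A *v x) \<bullet> (B *v x) = 0" using anti by simp
  then show ?thesis
    by (simp add: matrix_vector_mult_add_rdistrib power2_norm_eq_inner inner_add inner_commute)
qed

text \<open>Applied on the product space for the Cartesian product, but on the first factor alone
  for the semi-strong product.\<close>

lemma anticommuting_expansion:
  fixes A B :: "real ^ ('n::finite) ^ 'n"
  assumes "transpose A = A" "transpose B = B" "A ** B = - (B ** A)"
    and st: "s * norm x \<le> norm (A *v x)" "t * norm x \<le> norm (B *v x)" "0 \<le> s" "0 \<le> t"
  shows "sqrt (s\<^sup>2 + t\<^sup>2) * norm x \<le> norm ((A + B) *v x)"
proof (rule power2_le_imp_le)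
  show "(sqrt (s\<^sup>2 + t\<^sup>2) * norm x)\<^sup>2 \<le> (norm ((A + B) *v x))\<^sup>2"
    using power_mono[OF st(1), of 2] power_mono[OF st(2), of 2] st(3,4)
    by (simp add: anticommuting_pythagoras[OF assms(1-3)] power_mult_distrib distrib_right)
qed simp

section \<open>The class sign matrix of a bipartition\<close>

lemma class_sign_vector: "(class_sign V *v x) $ i = (if i \<in> V then x $ i else - x $ i)"
proof -
  have "class_sign V $ i $ j * x $ j = (if i = j then (if i \<in> V then x $ i else - x $ i) else 0)" for j
    by (simp add: class_sign_def)
  then show ?thesis by (simp add: matrix_vector_mult_def)
qed

lemma norm_class_sign: "norm (class_sign V *v x) = norm x"
  unfolding norm_vec_def by (rule L2_set_cong) (simp_all add: class_sign_vector)

lemma transpose_class_sign: "transpose (class_sign V) = class_sign V"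
  by (simp add: transpose_def class_sign_def vec_eq_iff)

lemma transpose_adj: "transpose (adj \<Gamma>) = adj \<Gamma>"
  by (simp add: transpose_def adj_def vec_eq_iff insert_commute)

text \<open>Multiplying by the class sign matrix on the right scales column \<open>v\<close>, on the
  left row \<open>u\<close>. Every edge joins the two classes, so at each nonzero entry the two
  factors are opposite.\<close>

lemma adj_class_sign_anticommute:
  fixes \<Gamma> :: "('v::finite) sgraph"
  assumes "bipartition \<Gamma> V W"
  shows "adj \<Gamma> ** class_sign V = - (class_sign V ** adj \<Gamma>)"
proof -
  have *: "(adj \<Gamma> ** class_sign V) $ u $ v = adj \<Gamma> $ u $ v * (if v \<in> V then 1 else - 1)"
    "(class_sign V ** adj \<Gamma>) $ u $ v = (if u \<in> V then 1 else - 1) * adj \<Gamma> $ u $ v" for u v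
    by (simp_all add: class_sign_def matrix_matrix_mult_def if_distrib[of "\<lambda>c. _ * c"]
        if_distrib[of "\<lambda>c. c * _"] cong: if_cong)
  have "(u \<in> V) \<noteq> (v \<in> V)" if "{u, v} \<in> edges \<Gamma>" for u v
    using that assms by (fastforce simp: bipartition_def doubleton_eq_iff)
  then have "(adj \<Gamma> ** class_sign V) $ u $ v = - (class_sign V ** adj \<Gamma>) $ u $ v" for u v
    unfolding vector_uminus_component * by (auto simp: adj_def)
  then show ?thesis by (simp add: vec_eq_iff)
qed

section \<open>The two degree bounds\<close>

theorem theorem1p3:
  fixes \<Gamma>\<^sub>1 :: "('a::finite) sgraph" and \<Gamma>\<^sub>2 :: "('b::finite) sgraph"
    and V\<^sub>1 V\<^sub>2 :: "'a set"
    and H H' :: "('a \<times> 'b) sgraph"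
    and lam mu :: real and n m :: nat
  assumes "signed_graph \<Gamma>\<^sub>1" and "verts \<Gamma>\<^sub>1 = UNIV" and "graph_order \<Gamma>\<^sub>1 = n"
    and "bipartition \<Gamma>\<^sub>1 V\<^sub>1 V\<^sub>2"
    and "signed_graph \<Gamma>\<^sub>2" and "verts \<Gamma>\<^sub>2 = UNIV" and "graph_order \<Gamma>\<^sub>2 = m"
    and "is_min_eigenvalue (adj \<Gamma>\<^sub>1 ** adj \<Gamma>\<^sub>1) (lam\<^sup>2)"
    and "is_min_eigenvalue (adj \<Gamma>\<^sub>2 ** adj \<Gamma>\<^sub>2) (mu\<^sup>2)"
    and "induced_sgraph H (signed_cartesian V\<^sub>1 \<Gamma>\<^sub>1 \<Gamma>\<^sub>2)"
    and "graph_order H = (m * n) div 2 + 1"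
    and "induced_sgraph H' (signed_semi_strong V\<^sub>1 \<Gamma>\<^sub>1 \<Gamma>\<^sub>2)"
    and "graph_order H' = (m * n) div 2 + 1"
    and "card V\<^sub>1 = card V\<^sub>2 \<or> symmetric_spectrum (adj \<Gamma>\<^sub>2)"
  shows "real (max_degree H) \<ge> sqrt (lam\<^sup>2 + mu\<^sup>2) \<and>
         real (max_degree H') \<ge> sqrt ((lam\<^sup>2 + 1) * mu\<^sup>2)"
proof
  let ?A = "adj \<Gamma>\<^sub>1" and ?B = "adj \<Gamma>\<^sub>2" and ?D = "class_sign V\<^sub>1"
  have mn: "m * n = CARD('a \<times> 'b)" using assms(2,3,6,7) by (simp add: graph_order_def)
  have A: "\<bar>lam\<bar> * norm x \<le> norm (?A *v x)" for x
    by (rule expansion_from_min_eigenvalue[OF transpose_adj assms(8)])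
  have B: "\<bar>mu\<bar> * norm x \<le> norm (?B *v x)" for x
    by (rule expansion_from_min_eigenvalue[OF transpose_adj assms(9)])
  have D: "1 * norm x \<le> norm (?D *v x)" for x by (simp add: norm_class_sign)
  have I: "1 * norm x \<le> norm (mat 1 *v x)" for x :: "real ^ 'b" by simp
  note anti = adj_class_sign_anticommute[OF assms(4)]
  show "sqrt (lam\<^sup>2 + mu\<^sup>2) \<le> real (max_degree H)"
  proof (rule max_degree_ge_of_expansion)
    let ?X = "kron ?A (mat 1) :: real ^ ('a \<times> 'b) ^ ('a \<times> 'b)" and ?Y = "kron ?D ?B"
    fix x :: "real ^ ('a \<times> 'b)"
    have "kron (- P) Q = - kron P Q" for P :: "real ^ 'a ^ 'a" and Q :: "real ^ 'b ^ 'b"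
      by (simp add: kron_def vec_eq_iff)
    \<comment> \<open>Both products have second factor \<open>?B\<close>; their first factors are
      \<open>?A ** ?D\<close> and \<open>?D ** ?A\<close>, so the anticommutation on the first graph
      carries over.\<close>
    then have "?X ** ?Y = - (?Y ** ?X)" by (simp add: kron_mult anti)
    moreover have "\<bar>lam\<bar> * norm x \<le> norm (?X *v x)" "\<bar>mu\<bar> * norm x \<le> norm (?Y *v x)"
      using kron_expansion[OF A I, of x] kron_expansion[OF D B, of x] by simp_all
    ultimately have "sqrt (\<bar>lam\<bar>\<^sup>2 + \<bar>mu\<bar>\<^sup>2) * norm x \<le> norm ((?X + ?Y) *v x)"
      by (intro anticommuting_expansion)
        (simp_all add: transpose_kron transpose_adj transpose_class_sign)
    then show "sqrt (lam\<^sup>2 + mu\<^sup>2) * norm x \<le> norm (adj (signed_cartesian V\<^sub>1 \<Gamma>\<^sub>1 \<Gamma>\<^sub>2) *v x)"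
      by (simp add: signed_cartesian_ok(2)[OF assms(1,5)] cartesian_matrix_def)
  qed (use assms signed_cartesian_ok(1) mn in auto)
  show "sqrt ((lam\<^sup>2 + 1) * mu\<^sup>2) \<le> real (max_degree H')"
  proof (rule max_degree_ge_of_expansion)
    fix x :: "real ^ ('a \<times> 'b)"
    \<comment> \<open>The class sign matrix preserves norms and so contributes the constant 1, the
      source of the summand 1 in the bound.\<close>
    have "sqrt (\<bar>lam\<bar>\<^sup>2 + 1\<^sup>2) * norm y \<le> norm ((?A + ?D) *v y)" for y
      by (rule anticommuting_expansion[OF transpose_adj transpose_class_sign anti A D]) simp_all
    then have "sqrt (\<bar>lam\<bar>\<^sup>2 + 1\<^sup>2) * \<bar>mu\<bar> * norm x \<le> norm (kron (?A + ?D) ?B *v x)"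
      by (rule kron_expansion[OF _ B]) simp_all
    then show "sqrt ((lam\<^sup>2 + 1) * mu\<^sup>2) * norm x \<le> norm (adj (signed_semi_strong V\<^sub>1 \<Gamma>\<^sub>1 \<Gamma>\<^sub>2) *v x)"
      by (simp add: signed_semi_strong_ok(2)[OF assms(1,5)] semi_strong_matrix_def real_sqrt_mult)
  qed (use assms signed_semi_strong_ok(1) mn in auto)
qed

end
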